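(* Let $p\equiv 1\pmod 4$ be a prime. (i) For each $a\in V$, letting $b=\overline{a}-a$, we have $b\in V$ and $\overline{b}=\widetilde{\overline{a}+a}$. (ii) $\{\overline{a}-a : a\in V\}=V$ and $\{\widetilde{\overline{a}+a} : a\in V\}=\{1,2,\ldots,(p-1)/2\}\setminus V$.
   Context: For an integer $x$, $\{x\}_p$ denotes the least nonnegative residue of $x$ modulo $p$, and $\widetilde{x}=p-\{x\}_p$ if $\{x\}_p>p/2$, while $\widetilde{x}=\{x\}_p$ if $\{x\}_p<p/2$. Let $t=\prod_{x=1}^{(p-1)/2}x$. Let $V=\{x : 1\le x\le (p-1)/2,\ x<\widetilde{tx}\}$, and for $a\in V$ put $\overline{a}=\widetilde{ta}$. *)

theory Defs
  imports "HOL-Number_Theory.Number_Theory"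
begin

text \<open>
  For an odd modulus \<open>p\<close> the case \<open>2 * (x mod p) = p\<close> does not arise.
\<close>

definition fold_res :: "int \<Rightarrow> int \<Rightarrow> int" where
  "fold_res p x = (if 2 * (x mod p) > p then p - x mod p else x mod p)"

definition half_fact :: "int \<Rightarrow> int" where
  "half_fact p = (\<Prod>x\<in>{1..(p - 1) div 2}. x)"

definition bar :: "int \<Rightarrow> int \<Rightarrow> int" where
  "bar p a = fold_res p (half_fact p * a)"

definition V :: "int \<Rightarrow> int set" where
  "V p = {x. 1 \<le> x \<and> x \<le> (p - 1) div 2 \<and> x < fold_res p (half_fact p * x)}"

end

theory Submission
  imports Defs
begin

text \<open>
  By Wilson's theorem \<open>t = half_fact p\<close> satisfies \<open>t\<^sup>2 \<equiv> -1\<close> modulo \<open>p\<close>, so \<open>bar p\<close> is a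
  fixed-point-free involution of \<open>{1..(p - 1) div 2}\<close> and \<open>V p\<close> picks the smaller element of
  each orbit. Writing \<open>A\<close> for the bar of \<open>a\<close>, we have \<open>A \<equiv> \<plusminus>t a\<close>, hence
  \<open>t (A - a) \<equiv> \<mp>(A + a)\<close>; this gives the first claim. The map \<open>a \<mapsto> A - a\<close> on the finite set
  \<open>V p\<close> is injective, since \<open>A - a\<close> determines \<open>A + a\<close> up to replacing it by \<open>p - (A + a)\<close>,
  and the parity of \<open>A + a\<close>, which is that of \<open>A - a\<close>, decides between the two as \<open>p\<close> is odd.
\<close>

lemma fold_res_cong:
  "p dvd fold_res p x - x \<or> p dvd fold_res p x + x"
proof -
  have "p dvd x mod p - x"
    by (metis mod_eq_dvd_iff mod_mod_trivial)
  moreover have "p dvd p - x mod p + x"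
    using dvd_diff[OF dvd_refl calculation] by (simp add: algebra_simps)
  ultimately show ?thesis
    by (simp add: fold_res_def)
qed

lemma fold_res_half_range:
  fixes p :: int
  assumes "p > 0" "odd p" "\<not> p dvd x"
  shows "fold_res p x \<in> {1..(p - 1) div 2}"
proof -
  have "x mod p \<noteq> 0" using assms by (simp add: dvd_eq_mod_eq_0)
  moreover have "0 \<le> x mod p" "x mod p < p" using assms by auto
  ultimately show ?thesis
    using assms(2) by (auto simp: fold_res_def elim!: oddE)
qed

text \<open>Turns divisibility up to sign into equality: each nonzero class modulo \<open>p\<close>
  has, up to sign, just one representative in the half range.\<close>

lemma fold_res_unique:
  fixes p :: int
  assumes "y \<in> {1..(p - 1) div 2}" "p dvd y - x \<or> p dvd y + x"
  shows "fold_res p x = y"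
proof -
  have y: "0 < y" "2 * y < p" using assms(1) by auto
  from assms(2) show ?thesis
  proof
    assume "p dvd y - x"
    then have "x mod p = y mod p" by (metis mod_eq_dvd_iff)
    then show ?thesis using y by (simp add: fold_res_def)
  next
    assume "p dvd y + x"
    then have "p dvd x - (p - y)"
      by (metis add.commute diff_diff_eq2 dvd_diff dvd_refl)
    then have "x mod p = (p - y) mod p" by (simp only: mod_eq_dvd_iff)
    also have "\<dots> = p - y" using y by (intro mod_pos_pos_trivial) auto
    finally show ?thesis using y by (simp add: fold_res_def)
  qed
qed

text \<open>In Wilson's product the factors above \<open>(p - 1) div 2\<close> are the
  \<open>p - x\<close> with \<open>x\<close> in the lower half, so modulo \<open>p\<close> they
  repeat the lower half up to sign.\<close>

lemma half_fact_square:
  fixes p :: int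
  assumes "prime p" "[p = 1] (mod 4)"
  shows "p dvd half_fact p * half_fact p + 1"
proof -
  define h where "h = (p - 1) div 2"
  have "p > 1" using assms(1) by (rule prime_gt_1_int)
  obtain k where k: "p = 4 * k + 1"
    using assms(2) by (metis cong_iff_lin cong_sym add.commute)
  have h: "p = 2 * h + 1" "even h" "0 < h"
    using k \<open>p > 1\<close> by (auto simp: h_def)
  have split: "{1..p - 1} = {1..h} \<union> {h + 1..p - 1}" using h by auto
  have "(\<Prod>x\<in>{1..p - 1}. x) = (\<Prod>x\<in>{1..h}. x) * (\<Prod>x\<in>{h + 1..p - 1}. x)"
    unfolding split by (rule prod.union_disjoint) auto
  also have "(\<Prod>x\<in>{h + 1..p - 1}. x) = (\<Prod>x\<in>{1..h}. p - x)"
    by (rule prod.reindex_bij_witness[of _ "\<lambda>x. p - x" "\<lambda>x. p - x"]) (use h in auto)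
  finally have full: "(\<Prod>x\<in>{1..p - 1}. x) = half_fact p * (\<Prod>x\<in>{1..h}. p - x)"
    by (simp add: half_fact_def h_def)
  have "[(\<Prod>x\<in>{1..h}. p - x) = (\<Prod>x\<in>{1..h}. - x)] (mod p)"
    by (rule cong_prod) (simp add: cong_iff_dvd_diff)
  \<comment> \<open>The \<open>h\<close> signs cancel because \<open>p = 4 * k + 1\<close> makes
    \<open>h\<close> even.\<close>
  also have "(\<Prod>x\<in>{1..h}. - x) = half_fact p"
    using h by (simp add: prod_uminus even_nat_iff half_fact_def h_def)
  finally have "[(\<Prod>x\<in>{1..p - 1}. x) = half_fact p * half_fact p] (mod p)"
    unfolding full by (rule cong_scalar_left)
  moreover have "(\<Prod>x\<in>{1..p - 1}. x) = fact (nat p - 1)"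
  proof -
    have "fact (nat p - 1) = (\<Prod>i\<in>{1..nat p - 1}. int i)"
      by (simp add: fact_prod)
    also have "\<dots> = (\<Prod>x\<in>{1..p - 1}. x)"
      by (rule prod.reindex_bij_witness[of _ nat int]) auto
    finally show ?thesis by simp
  qed
  moreover have "[fact (nat p - 1) = - 1] (mod p)"
    using wilson_theorem[of "nat p"] assms(1) \<open>p > 1\<close> by simp
  ultimately have "[half_fact p * half_fact p = - 1] (mod p)"
    by (metis cong_sym cong_trans)
  then show ?thesis by (simp add: cong_iff_dvd_diff)
qed

theorem theorem2p4:
  fixes p :: int
  assumes "prime p" and "[p = 1] (mod 4)"
  shows "(\<forall>a\<in>V p. bar p a - a \<in> V p \<and> bar p (bar p a - a) = fold_res p (bar p a + a))
       \<and> {bar p a - a | a. a \<in> V p} = V p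
       \<and> {fold_res p (bar p a + a) | a. a \<in> V p} = {1..(p - 1) div 2} - V p"
proof -
  define H where "H = {1..(p - 1) div 2}"
  define t where "t = half_fact p"
  have "p > 1" using assms(1) by (rule prime_gt_1_int)
  have "odd p" using assms(2) by (auto simp: cong_def) presburger
  have H_bounds: "0 < a \<and> 2 * a < p" if "a \<in> H" for a
    using that by (auto simp: H_def)
  have H_not_dvd: "\<not> p dvd a" if "a \<in> H" for a
    using H_bounds[OF that] by (auto dest: zdvd_imp_le)
  have tt: "p dvd t * t + 1"
    unfolding t_def using assms by (rule half_fact_square)
  have "\<not> p dvd t"
  proof
    assume "p dvd t"
    with tt have "p dvd 1" by (metis dvd_add_right_iff dvd_mult)
    then show False using \<open>p > 1\<close> by (simp add: zdvd1_eq)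
  qed
  have bar_cong: "p dvd bar p a - t * a \<or> p dvd bar p a + t * a" for a
    unfolding bar_def t_def by (rule fold_res_cong)
  have bar_H: "bar p a \<in> H" if "a \<in> H" for a
    unfolding bar_def H_def t_def[symmetric]
    using \<open>p > 1\<close> \<open>odd p\<close> \<open>\<not> p dvd t\<close> H_not_dvd[OF that] assms(1)
    by (intro fold_res_half_range) (auto simp: prime_dvd_mult_iff)
  have bar_bar: "bar p (bar p a) = a" if "a \<in> H" for a
  proof -
    \<comment> \<open>Combining this multiple of \<open>p\<close> with \<open>t\<close> times the
      congruence for \<open>bar p a\<close> cancels the terms in \<open>t * t * a\<close>.\<close>
    have *: "p dvd (t * t + 1) * a" using tt by simp
    have "p dvd a - t * bar p a \<or> p dvd a + t * bar p a"
      using bar_cong[of a]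
    proof
      assume "p dvd bar p a - t * a"
      then have "p dvd t * (bar p a - t * a)" by simp
      from dvd_add[OF this *] show ?thesis by (simp add: algebra_simps)
    next
      assume "p dvd bar p a + t * a"
      then have "p dvd t * (bar p a + t * a)" by simp
      from dvd_diff[OF * this] show ?thesis by (simp add: algebra_simps)
    qed
    then show ?thesis
      using fold_res_unique that by (simp add: bar_def H_def t_def)
  qed
  have bar_neq: "bar p a \<noteq> a" if "a \<in> H" for a
  proof
    assume eq: "bar p a = a"
    \<comment> \<open>A fixed point would force \<open>t * t\<close> to be congruent to 1 as well as
      to -1, hence \<open>p\<close> to divide 2.\<close>
    have "p dvd (t - 1) * (t + 1) * a"
      using bar_cong[of a] unfolding eq
    proof
      assume "p dvd a - t * a"
      then have "p dvd (a - t * a) * - (t + 1)" by (rule dvd_mult2)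
      then show ?thesis by (simp add: algebra_simps)
    next
      assume "p dvd a + t * a"
      then have "p dvd (a + t * a) * (t - 1)" by (rule dvd_mult2)
      then show ?thesis by (simp add: algebra_simps)
    qed
    then have "p dvd (t - 1) * (t + 1)"
      using assms(1) H_not_dvd[OF that] by (simp only: prime_dvd_mult_iff) simp
    from dvd_diff[OF tt this] have "p dvd 2" by (simp add: algebra_simps)
    then show False
      using \<open>p > 1\<close> \<open>odd p\<close> zdvd_imp_le[of p 2] by (cases "p = 2") auto
  qed
  have V_iff: "a \<in> V p \<longleftrightarrow> a \<in> H \<and> a < bar p a" for a
    by (auto simp: V_def H_def bar_def)
  have part1: "bar p a - a \<in> V p \<and> bar p (bar p a - a) = fold_res p (bar p a + a)"
    and fold_sum: "fold_res p (bar p a + a) \<in> {bar p a + a, p - (bar p a + a)}"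
    if "a \<in> V p" for a
  proof -
    define A where "A = bar p a"
    have a: "a \<in> H" "a < A" "A \<in> H" using that bar_H by (auto simp: V_iff A_def)
    note bounds = H_bounds[OF a(1)] H_bounds[OF a(3)]
    have b: "A - a \<in> H" using a by (auto simp: H_def)
    have sum: "fold_res p (A + a) \<in> {A + a, p - (A + a)}"
      using bounds by (auto simp: fold_res_def)
    have *: "p dvd (t * t + 1) * a" using tt by simp
    have "p dvd bar p (A - a) - (A + a) \<or> p dvd bar p (A - a) + (A + a)"
    proof -
      \<comment> \<open>The factors \<open>t + 1\<close> and \<open>t - 1\<close> below produce
        \<open>t * A\<close> and \<open>A\<close> together; \<open>*\<close> then removes
        \<open>t * t * a\<close> and supplies the missing \<open>a\<close>.\<close>
      have "p dvd t * (A - a) - (A + a) \<or> p dvd t * (A - a) + (A + a)"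
        using bar_cong[of a] unfolding A_def[symmetric]
      proof
        assume "p dvd A - t * a"
        then have "p dvd (t + 1) * (A - t * a)" by simp
        from dvd_add[OF this *] show ?thesis by (simp add: algebra_simps)
      next
        assume "p dvd A + t * a"
        then have "p dvd (t - 1) * (A + t * a)" by simp
        from dvd_diff[OF this *] show ?thesis by (simp add: algebra_simps)
      qed
      then show ?thesis
        using bar_cong[of "A - a"]
        by (smt (verit) dvd_add dvd_diff)
    qed
    then have eq: "fold_res p (A + a) = bar p (A - a)"
      using bar_H[OF b] unfolding H_def by (intro fold_res_unique) auto
    \<comment> \<open>Both candidates exceed \<open>A - a\<close>: the sum since
      \<open>a > 0\<close>, its complement since \<open>2 * A < p\<close>.\<close>
    have "A - a < fold_res p (A + a)" using sum bounds by auto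
    with b eq show "bar p a - a \<in> V p \<and> bar p (bar p a - a) = fold_res p (bar p a + a)"
      by (simp add: V_iff A_def)
    show "fold_res p (bar p a + a) \<in> {bar p a + a, p - (bar p a + a)}"
      using sum by (simp add: A_def)
  qed
  have "inj_on (\<lambda>a. bar p a - a) (V p)"
  proof (rule inj_onI)
    fix a c assume ac: "a \<in> V p" "c \<in> V p" and eq: "bar p a - a = bar p c - c"
    then have "fold_res p (bar p a + a) = fold_res p (bar p c + c)"
      using part1 by metis
    with fold_sum[OF ac(1)] fold_sum[OF ac(2)]
    have "bar p a + a = bar p c + c \<or> bar p a + a = p - (bar p c + c)" by auto
    \<comment> \<open>In the second case, adding \<open>eq\<close> gives
      \<open>2 * bar p a = p - 2 * c\<close>, impossible for odd \<open>p\<close>.\<close>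
    then show "a = c"
      using eq \<open>odd p\<close> by presburger
  qed
  moreover have "finite (V p)"
    by (rule finite_subset[of _ H]) (auto simp: V_iff H_def)
  ultimately have image: "(\<lambda>a. bar p a - a) ` V p = V p"
    using part1 by (intro endo_inj_surj) auto
  \<comment> \<open>The folded sums are the bars of the differences, and the differences fill
    \<open>V p\<close>; it remains to see that \<open>bar p\<close> carries \<open>V p\<close> onto
    its complement in \<open>H\<close>.\<close>
  have "(\<lambda>a. fold_res p (bar p a + a)) ` V p = bar p ` (\<lambda>a. bar p a - a) ` V p"
    using part1 by (simp add: image_image)
  also have "\<dots> = bar p ` V p" unfolding image ..
  also have "\<dots> = H - V p"
  proof (intro equalityI subsetI)
    fix x assume "x \<in> bar p ` V p"
    then show "x \<in> H - V p" using bar_H bar_bar by (auto simp: V_iff)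
  next
    fix x assume "x \<in> H - V p"
    then have "bar p x \<in> V p" "x = bar p (bar p x)"
      using bar_H[of x] bar_bar[of x] bar_neq[of x] by (auto simp: V_iff)
    then show "x \<in> bar p ` V p" by blast
  qed
  finally have "(\<lambda>a. fold_res p (bar p a + a)) ` V p = H - V p" .
  with image part1 show ?thesis
    by (simp add: H_def image_def Setcompr_eq_image)
qed

end
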